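(* Every $6$-regular graph with at least $14$ vertices has an internal partition.
   Context: Graphs are finite and simple. For $S\subseteq V$ and $v\in V$, $d_S(v)$ is the number of neighbors of $v$ in $S$, and $d(v)$ is the degree of $v$. An internal partition of $G=(V,E)$ is a partition $V=A\dot\cup B$ with $A,B\neq\emptyset$ such that $d_A(x)\ge d(x)/2$ for every $x\in A$ and $d_B(y)\ge d(y)/2$ for every $y\in B$. *)

theory Defs
  imports Complex_Main "Graph_Theory.Pair_Digraph"
begin

text \<open>
  A finite simple graph is a \<^locale>\<open>pair_graph\<close>: the finite vertex set is \<^term>\<open>pverts G\<close>, and
  each undirected edge \<open>uv\<close> is represented by both pairs \<open>(u, v)\<close> and \<open>(v, u)\<close> in the
  symmetric, irreflexive relation \<^term>\<open>parcs G\<close>.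
\<close>

definition neighbors :: "'a pair_pre_digraph \<Rightarrow> 'a \<Rightarrow> 'a set" where
  "neighbors G v = {u \<in> pverts G. (v, u) \<in> parcs G}"

definition degree :: "'a pair_pre_digraph \<Rightarrow> 'a \<Rightarrow> nat" where
  "degree G v = card (neighbors G v)"

definition degree_in :: "'a pair_pre_digraph \<Rightarrow> 'a set \<Rightarrow> 'a \<Rightarrow> nat" where
  "degree_in G S v = card (neighbors G v \<inter> S)"

definition regular :: "'a pair_pre_digraph \<Rightarrow> nat \<Rightarrow> bool" where
  "regular G k \<longleftrightarrow> (\<forall>v \<in> pverts G. degree G v = k)"

definition internal_partition :: "'a pair_pre_digraph \<Rightarrow> 'a set \<Rightarrow> 'a set \<Rightarrow> bool" where
  "internal_partition G A B \<longleftrightarrow>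
     A \<union> B = pverts G \<and> A \<inter> B = {} \<and> A \<noteq> {} \<and> B \<noteq> {} \<and>
     (\<forall>x \<in> A. real (degree_in G A x) \<ge> real (degree G x) / 2) \<and>
     (\<forall>y \<in> B. real (degree_in G B y) \<ge> real (degree G y) / 2)"

end

theory Submission
  imports Defs
begin

text \<open>
  Call a set \<^emph>\<open>cohesive\<close> if its induced subgraph has minimum degree at least 3; two disjoint nonempty
  cohesive sets extend to an internal partition. Let \<open>A \<union> B\<close> be a partition with
  \<open>|A| = \<lceil>n/2\<rceil>\<close> and the fewest crossing edges. If \<open>y \<in> B\<close> violates cohesiveness, comparing with the
  partition where \<open>x \<in> A\<close> and \<open>y\<close> are exchanged gives \<open>d\<^sub>B(x) \<le> d\<^sub>B(y) + [x \<sim> y]\<close>. So \<open>A\<close> is cohesive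
  and at most \<open>2|A| + 4\<close> edges cross, while without an internal partition \<open>B\<close> is 2-degenerate and
  at least \<open>2|B| + 6\<close> edges cross. This is contradictory unless \<open>|A| = |B| + 1\<close>, and then
  \<open>d\<^sub>B(x) = 2 + [x \<sim> y]\<close> for every \<open>x \<in> A\<close>.

  In that case move \<open>y\<close> to \<open>A\<close>, giving \<open>Q = A \<union> {y}\<close> and \<open>P = B - {y}\<close>; every vertex of \<open>Q\<close> has exactly
  two neighbours in \<open>P\<close>. Some \<open>p \<in> P\<close> has at most two neighbours in \<open>P\<close>. For each \<open>x \<in> Q\<close> not
  adjacent to \<open>p\<close>, the partition \<open>(Q - {x}, P \<union> {x})\<close> is again optimal with violating vertex \<open>p\<close>, which forces
  \<open>N(x) \<inter> Q = N(p) \<inter> Q\<close>. A vertex of \<open>N(p) \<inter> Q\<close> therefore has at least \<open>|Q| - 4 \<ge> 5\<close> neighbours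
  in \<open>Q\<close>, but it has only four.
\<close>

section \<open>Degrees into sets, cuts and optimal bipartitions of regular graphs\<close>

locale regular_pair_graph = pair_graph G for G :: "'a pair_pre_digraph" +
  fixes r :: nat
  assumes regular: "regular G r"
begin

abbreviation V :: "'a set" where "V \<equiv> pverts G"

definition adj :: "'a \<Rightarrow> 'a \<Rightarrow> nat" where
  "adj u v = of_bool ((u, v) \<in> parcs G)"

definition d :: "'a set \<Rightarrow> 'a \<Rightarrow> nat" where
  "d S v = (\<Sum>u\<in>S. adj v u)"

text \<open>For disjoint sets this counts crossing edges; \<open>cut S S\<close> counts each inner
  edge twice.\<close>

definition cut :: "'a set \<Rightarrow> 'a set \<Rightarrow> nat" where
  "cut S T = (\<Sum>u\<in>S. d T u)"

definition cohesive :: "nat \<Rightarrow> 'a set \<Rightarrow> bool" where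
  "cohesive k S \<longleftrightarrow> (\<forall>v\<in>S. k \<le> d S v)"

definition bipartition :: "'a set \<Rightarrow> 'a set \<Rightarrow> bool" where
  "bipartition A B \<longleftrightarrow> A \<union> B = V \<and> A \<inter> B = {}"

definition min_bipartition :: "'a set \<Rightarrow> 'a set \<Rightarrow> bool" where
  "min_bipartition A B \<longleftrightarrow> bipartition A B \<and>
     (\<forall>A' B'. bipartition A' B' \<longrightarrow> card A' = card A \<longrightarrow> cut A B \<le> cut A' B')"

lemma adj_commute: "adj u v = adj v u"
  unfolding adj_def using sym_arcs by (auto simp: symmetric_def dest: symD)

lemma adj_self [simp]: "adj v v = 0"
  unfolding adj_def using no_loops' by auto

lemma adj_le_1: "adj u v \<le> 1"
  by (simp add: adj_def)

lemma finite_subset_V: "S \<subseteq> V \<Longrightarrow> finite S"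
  using finite_subset pair_finite_verts by blast

lemma d_eq_degree_in:
  assumes "S \<subseteq> V"
  shows "d S v = degree_in G S v"
proof -
  have "neighbors G v \<inter> S = {u \<in> S. (v, u) \<in> parcs G}"
    using assms by (auto simp: neighbors_def)
  then show ?thesis
    using finite_subset_V[OF assms] by (simp add: d_def adj_def degree_in_def Int_def)
qed

lemma d_V:
  assumes "v \<in> V"
  shows "d V v = r"
proof -
  have "neighbors G v \<inter> V = neighbors G v"
    by (auto simp: neighbors_def)
  then show ?thesis
    using assms regular d_eq_degree_in[of V v]
    by (simp add: degree_in_def regular_def degree_def)
qed

lemma d_empty [simp]: "d {} v = 0"
  by (simp add: d_def)

lemma d_insert [simp]: "finite S \<Longrightarrow> x \<notin> S \<Longrightarrow> d (insert x S) v = d S v + adj v x"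
  by (simp add: d_def)

lemma d_mono: "finite T \<Longrightarrow> S \<subseteq> T \<Longrightarrow> d S v \<le> d T v"
  by (simp add: d_def sum_mono2)

lemma sum_adj_left: "(\<Sum>u\<in>S. adj u v) = d S v"
  by (simp add: d_def adj_commute)

lemma bipartition_finite:
  assumes "bipartition A B"
  shows "finite A" "finite B"
  using assms finite_subset_V[of A] finite_subset_V[of B] by (auto simp: bipartition_def)

lemma bipartition_commute: "bipartition A B \<longleftrightarrow> bipartition B A"
  by (auto simp: bipartition_def)

lemma card_bipartition: "bipartition A B \<Longrightarrow> card A + card B = card V"
  using bipartition_finite[of A B] card_Un_disjoint[of A B] by (simp add: bipartition_def)

lemma d_bipartition:
  assumes "bipartition A B" "v \<in> V"
  shows "d A v + d B v = r"
proof -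
  have "d V v = d A v + d B v"
    using assms(1) bipartition_finite[OF assms(1)]
    unfolding d_def bipartition_def by (metis sum.union_disjoint)
  then show ?thesis
    using d_V[OF assms(2)] by simp
qed

lemma cut_commute: "cut S T = cut T S"
  unfolding cut_def d_def by (subst sum.swap) (simp add: adj_commute)

lemma cut_insert_left:
  "finite S \<Longrightarrow> x \<notin> S \<Longrightarrow> cut (insert x S) T = cut S T + d T x"
  by (simp add: cut_def)

lemma cut_insert_right:
  "finite T \<Longrightarrow> x \<notin> T \<Longrightarrow> cut S (insert x T) = cut S T + d S x"
  using cut_insert_left[of T x S] by (simp add: cut_commute)

lemma cut_self_plus_cut:
  assumes "bipartition A B"
  shows "cut B B + cut A B = r * card B"
proof -
  have "cut B B + cut B A = (\<Sum>v\<in>B. d A v + d B v)"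
    by (simp add: cut_def sum.distrib)
  also have "\<dots> = (\<Sum>v\<in>B. r)"
    using d_bipartition[OF assms] assms by (intro sum.cong) (auto simp: bipartition_def)
  finally show ?thesis
    by (simp add: cut_commute[of B A])
qed

lemma ex_min_bipartition:
  assumes "m \<le> card V"
  shows "\<exists>A B. min_bipartition A B \<and> card A = m"
proof -
  obtain S where S: "S \<subseteq> V" "card S = m"
    using obtain_subset_with_card_n[OF assms] by blast
  define P where "P = (\<lambda>(A, B). bipartition A B \<and> card A = m)"
  have "P (S, V - S)"
    using S by (auto simp: P_def bipartition_def)
  from ex_has_least_nat[of P, OF this, of "\<lambda>(A, B). cut A B"]
  show ?thesis
    by (fastforce simp: P_def min_bipartition_def)
qed

lemma min_bipartition_commute:
  assumes "min_bipartition A B"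
  shows "min_bipartition B A"
  unfolding min_bipartition_def
proof (intro conjI allI impI)
  show "bipartition B A"
    using assms by (simp add: min_bipartition_def bipartition_commute)
  fix A' B' assume A': "bipartition A' B'" "card A' = card B"
  then have "card B' = card A"
    using card_bipartition[of A' B'] card_bipartition[of A B] assms
    by (simp add: min_bipartition_def)
  with A' assms have "cut A B \<le> cut B' A'"
    by (simp add: min_bipartition_def bipartition_commute)
  then show "cut B A \<le> cut A' B'"
    by (simp add: cut_commute)
qed

text \<open>Exchanging \<open>x\<close> and \<open>y\<close> cannot lower the cut. By regularity the
  gains on the two sides agree, so the resulting inequality can be halved to one about
  \<open>B\<close> alone; \<open>adj x y\<close> appears because the edge \<open>xy\<close> crosses
  before and after.\<close>

lemma min_bipartition_swap:
  assumes "min_bipartition A B" "x \<in> A" "y \<in> B"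
  shows "d B x \<le> d B y + adj x y"
proof -
  define A0 B0 where "A0 = A - {x}" and "B0 = B - {y}"
  have bip: "bipartition A B"
    using assms(1) by (simp add: min_bipartition_def)
  note fin = bipartition_finite[OF bip]
  have AB: "A = insert x A0" "B = insert y B0" "x \<notin> A0" "y \<notin> B0" "x \<notin> B0" "y \<notin> A0"
    and fin0: "finite A0" "finite B0"
    using assms bip fin by (auto simp: A0_def B0_def bipartition_def)
  have "bipartition (insert y A0) (insert x B0)"
    using bip AB by (auto simp: bipartition_def)
  moreover have "card (insert y A0) = card A"
    using AB fin0 by simp
  ultimately have "cut A B \<le> cut (insert y A0) (insert x B0)"
    using assms(1) by (simp add: min_bipartition_def)
  then have "d B0 x + d A0 y \<le> d B0 y + d A0 x"
    using AB fin0 by (simp add: cut_insert_left cut_insert_right adj_commute[of y x])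
  moreover have "d A x + d B x = d A y + d B y"
    using d_bipartition[OF bip] assms bip by (auto simp: bipartition_def)
  ultimately show ?thesis
    using AB fin0 by (simp add: adj_commute[of y x])
qed

text \<open>Removing vertices with at most two remaining neighbours until two vertices are left
  shows that \<open>S\<close> spans at most 2(|S| - 2) + 1 edges; \<open>cut S S\<close> is twice
  that.\<close>

lemma degenerate_cut_self:
  assumes "S \<subseteq> V" "2 \<le> card S"
    and "\<And>T. T \<subseteq> S \<Longrightarrow> T \<noteq> {} \<Longrightarrow> \<not> cohesive 3 T"
  shows "cut S S + 6 \<le> 4 * card S"
  using assms
proof (induction "card S - 2" arbitrary: S)
  case 0
  then have "card S = 2"
    by simp
  then obtain x y where "S = {x, y}" "x \<noteq> y"
    by (metis card_2_iff)
  then show ?case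
    using adj_le_1[of x y] adj_le_1[of y x] by (simp add: cut_def)
next
  case (Suc n)
  have fin: "finite S"
    using Suc.prems finite_subset_V by blast
  have "S \<noteq> {}"
    using Suc.prems by auto
  then obtain x where x: "x \<in> S" "d S x < 3"
    using Suc.prems(3)[of S] by (auto simp: cohesive_def not_le)
  define S' where "S' = S - {x}"
  have S: "S = insert x S'" "x \<notin> S'" "finite S'"
    using x fin by (auto simp: S'_def)
  have "cut S' S' + 6 \<le> 4 * card S'"
  proof (rule Suc.hyps(1))
    show "n = card S' - 2" "2 \<le> card S'"
      using Suc.hyps(2) S by simp_all
    show "S' \<subseteq> V"
      using Suc.prems(1) by (auto simp: S'_def)
    show "\<not> cohesive 3 T" if "T \<subseteq> S'" "T \<noteq> {}" for T
      using Suc.prems(3)[of T] that by (auto simp: S'_def)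
  qed
  moreover have "cut S S = cut S' S' + 2 * d S' x"
    using S by (simp add: cut_insert_left cut_insert_right)
  moreover have "d S' x \<le> 2"
    using x S by simp
  ultimately show ?case
    using S by simp
qed

end

section \<open>Extending disjoint cohesive sets to an internal partition\<close>

locale six_regular = regular_pair_graph G 6 for G :: "'a pair_pre_digraph"
begin

lemma internal_partition_if_cohesive:
  assumes "bipartition A B" "A \<noteq> {}" "B \<noteq> {}" "cohesive 3 A" "cohesive 3 B"
  shows "internal_partition G A B"
proof -
  have "A \<subseteq> V" "B \<subseteq> V"
    using assms(1) by (auto simp: bipartition_def)
  then show ?thesis
    using assms regular
    by (auto simp: internal_partition_def bipartition_def cohesive_def d_eq_degree_in regular_def
        subset_iff)
qed

text \<open>Enlarge \<open>S\<close> to a largest cohesive \<open>A\<close> avoiding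
  \<open>T\<close>. A vertex outside both has at most two neighbours in \<open>A\<close>, hence at
  least four in the complement; vertices of \<open>T\<close> are served by \<open>T\<close>.\<close>

lemma internal_partition_if_disjoint_cohesive:
  assumes "S \<subseteq> V" "T \<subseteq> V" "S \<inter> T = {}" "S \<noteq> {}" "T \<noteq> {}" "cohesive 3 S" "cohesive 3 T"
  shows "\<exists>A B. internal_partition G A B"
proof -
  define P where "P = (\<lambda>A. A \<subseteq> V \<and> A \<inter> T = {} \<and> A \<noteq> {} \<and> cohesive 3 A)"
  have "\<exists>A. P A \<and> (\<forall>A'. P A' \<longrightarrow> card A' \<le> card A)"
    using assms by (intro ex_has_greatest_nat[of P S card "Suc (card V)"])
      (auto simp: P_def less_Suc_eq_le card_mono)
  then obtain A where A: "P A" and max: "\<And>A'. P A' \<Longrightarrow> card A' \<le> card A"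
    by blast
  have AV: "A \<subseteq> V" and fin: "finite A"
    using A finite_subset_V by (auto simp: P_def)
  have bip: "bipartition A (V - A)"
    using AV by (auto simp: bipartition_def)
  have "3 \<le> d (V - A) v" if v: "v \<in> V - A" for v
  proof (cases "v \<in> T")
    case True
    have "d T v \<le> d (V - A) v"
      using A assms by (intro d_mono) (auto simp: P_def)
    then show ?thesis
      using True assms by (auto simp: cohesive_def)
  next
    case False
    have "\<not> P (insert v A)"
      using max[of "insert v A"] v fin by auto
    then have "\<not> cohesive 3 (insert v A)"
      using False v A by (auto simp: P_def)
    then have "d A v < 3"
      using v A fin by (fastforce simp: cohesive_def P_def)
    then show ?thesis
      using d_bipartition[OF bip] v by fastforce
  qed
  then have "cohesive 3 (V - A)"
    by (simp add: cohesive_def)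
  then have "internal_partition G A (V - A)"
    using A assms by (intro internal_partition_if_cohesive bip) (auto simp: P_def)
  then show ?thesis
    by blast
qed

end

section \<open>Optimal bipartitions of a hypothetical counterexample\<close>

locale six_regular_no_internal = six_regular +
  assumes no_internal: "\<not> internal_partition G A B"
begin

lemma not_both_cohesive:
  assumes "bipartition A B" "A \<noteq> {}" "cohesive 3 A" "T \<subseteq> B" "T \<noteq> {}"
  shows "\<not> cohesive 3 T"
proof -
  have "A \<subseteq> V" "T \<subseteq> V" "A \<inter> T = {}"
    using assms by (auto simp: bipartition_def)
  then show ?thesis
    using internal_partition_if_disjoint_cohesive[of A T] assms no_internal by blast
qed

lemma cut_ge:
  assumes "bipartition A B" "A \<noteq> {}" "cohesive 3 A" "2 \<le> card B"
  shows "2 * card B + 6 \<le> cut A B"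
proof -
  have "cut B B + 6 \<le> 4 * card B"
    using assms not_both_cohesive[OF assms(1-3)]
    by (intro degenerate_cut_self) (auto simp: bipartition_def)
  then show ?thesis
    using cut_self_plus_cut[OF assms(1)] by simp
qed

lemma min_bipartition_violation:
  assumes min: "min_bipartition A B" and y: "y \<in> B" "d B y \<le> 2"
    and card: "2 \<le> card A" "2 \<le> card B"
  shows "cohesive 3 A" and "card B < card A"
    and "card A = Suc (card B) \<Longrightarrow> d B y = 2 \<and> (\<forall>x\<in>A. d B x = 2 + adj x y)"
proof -
  have bip: "bipartition A B"
    using min by (simp add: min_bipartition_def)
  note fin = bipartition_finite[OF bip]
  have le: "d B x \<le> d B y + adj x y" if "x \<in> A" for x
    using min_bipartition_swap[OF min that y(1)] .
  have deg: "d A x + d B x = 6" if "x \<in> A \<union> B" for x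
    using d_bipartition[OF bip] that bip by (auto simp: bipartition_def)
  show coh: "cohesive 3 A"
    unfolding cohesive_def
  proof
    fix x assume "x \<in> A"
    then show "3 \<le> d A x"
      using le[of x] deg[of x] y adj_le_1[of x y] by simp
  qed
  have "A \<noteq> {}"
    using card by auto
  from cut_ge[OF bip this coh card(2)] have ge: "2 * card B + 6 \<le> cut A B" .
  have sum: "(\<Sum>x\<in>A. k + adj x y) = card A * k + d A y" for k
    by (simp add: sum.distrib sum_adj_left)
  have "cut A B \<le> (\<Sum>x\<in>A. d B y + adj x y)"
    unfolding cut_def by (intro sum_mono le)
  then have up: "cut A B \<le> card A * d B y + d A y"
    by (simp only: sum)
  \<comment> \<open>Fixing the value makes the product linear. The value 2 gives d(A, y) = 4 and
    equality; 0 and 1 stay strictly below because \<open>2 \<le> card A\<close>.\<close>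
  have "d B y = 0 \<or> d B y = 1 \<or> d B y = 2"
    using y(2) by linarith
  then have up': "card A * d B y + d A y \<le> 2 * card A + 4 \<and>
      (card A * d B y + d A y = 2 * card A + 4 \<longrightarrow> d B y = 2)"
    using deg[of y] y(1) card by auto
  with ge up show "card B < card A"
    by linarith
  assume eq: "card A = Suc (card B)"
  then have k: "d B y = 2" and c: "cut A B = 2 * card B + 6"
    using ge up up' by auto
  have "(\<Sum>x\<in>A. d B x) = (\<Sum>x\<in>A. 2 + adj x y)"
    using sum[of 2] c eq k deg[of y] y(1) by (simp add: cut_def)
  \<comment> \<open>Termwise bounds with equal totals are equalities.\<close>
  then have "d B x = 2 + adj x y" if "x \<in> A" for x
    using sum_mono_inv[of "d B" A "\<lambda>x. 2 + adj x y" x] le fin that k by simp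
  with k show "d B y = 2 \<and> (\<forall>x\<in>A. d B x = 2 + adj x y)"
    by blast
qed

text \<open>A violating vertex forces the other side to be strictly larger, so none lies in
  \<open>A\<close>; one must then lie in \<open>B\<close>, which excludes equal sizes.\<close>

lemma min_bipartition_larger:
  assumes min: "min_bipartition A B" and card: "card B \<le> card A" "2 \<le> card B"
  shows "\<exists>y\<in>B. d B y \<le> 2" and "card B < card A"
proof -
  have bip: "bipartition A B"
    using min by (simp add: min_bipartition_def)
  have coh: "cohesive 3 A"
  proof (rule ccontr)
    assume "\<not> cohesive 3 A"
    then obtain x where "x \<in> A" "d A x \<le> 2"
      by (auto simp: cohesive_def not_le)
    from min_bipartition_violation(2)[OF min_bipartition_commute[OF min] this] card
    show False by simp
  qed
  have "A \<noteq> {}" "B \<noteq> {}"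
    using card by auto
  then have "\<not> cohesive 3 B"
    using not_both_cohesive[OF bip _ coh] by simp
  then show ex: "\<exists>y\<in>B. d B y \<le> 2"
    by (force simp: cohesive_def not_le)
  then show "card B < card A"
    using min_bipartition_violation(2)[OF min] card by auto
qed

lemma min_bipartition_tight:
  assumes min: "min_bipartition A B" and card: "card A = Suc (card B)" "7 \<le> card B"
  shows False
proof -
  have bip: "bipartition A B"
    using min by (simp add: min_bipartition_def)
  note fin = bipartition_finite[OF bip]
  obtain s where s: "s \<in> B" "d B s \<le> 2"
    using min_bipartition_larger(1)[OF min] card by auto
  have ds: "d B s = 2" and dA: "\<And>x. x \<in> A \<Longrightarrow> d B x = 2 + adj x s"
    using min_bipartition_violation(3)[OF min s _ _ card(1)] card by auto
  define P Q where "P = B - {s}" and "Q = insert s A"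
  have B: "B = insert s P" "s \<notin> P" "finite P" and sA: "s \<notin> A"
    using s fin bip by (auto simp: P_def bipartition_def)
  have bipQ: "bipartition Q P" and finQ: "finite Q" and cardQ: "9 \<le> card Q"
    using bip s fin sA card by (auto simp: P_def Q_def bipartition_def)
  have card_Q: "card Q = Suc (card A)"
    using fin sA by (simp add: Q_def)
  \<comment> \<open>For \<open>x\<close> in \<open>A\<close>, deleting \<open>s\<close> from
    \<open>B\<close> removes exactly the summand \<open>adj x s\<close>.\<close>
  have dP: "d P x = 2" if "x \<in> Q" for x
    using that dA[of x] ds B by (auto simp: Q_def)
  have QV: "Q \<subseteq> V" "P \<subseteq> V"
    using bipQ by (auto simp: bipartition_def)
  have dQ: "d Q x = 4" if "x \<in> Q" for x
    using d_bipartition[OF bipQ, of x] dP[OF that] that QV by auto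
  have cohQ: "cohesive 3 Q"
    by (simp add: cohesive_def dQ)
  have "P \<noteq> {}"
    using B card by auto
  moreover have "Q \<noteq> {}"
    by (simp add: Q_def)
  ultimately have "\<not> cohesive 3 P"
    using not_both_cohesive[OF bipQ _ cohQ, of P] by simp
  then obtain p where p: "p \<in> P" "d P p \<le> 2"
    by (auto simp: cohesive_def not_le)
  have twin: "d P p = 2 \<and> (\<forall>y\<in>Q - {x}. adj y x = adj y p)" if x: "x \<in> Q" "adj x p = 0" for x
  proof -
    define A' B' where "A' = Q - {x}" and "B' = insert x P"
    have xP: "x \<notin> P"
      using x bipQ by (auto simp: bipartition_def)
    have Q: "Q = insert x A'" "x \<notin> A'" "finite A'"
      using x finQ by (auto simp: A'_def)
    have bip': "bipartition A' B'"
      using bipQ x xP by (auto simp: A'_def B'_def bipartition_def)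
    have cards: "card A' = card A" "card B' = card B"
      using x finQ card_Q B xP by (simp_all add: A'_def B'_def)
    \<comment> \<open>Both cuts arise from \<open>cut Q P\<close> by moving one vertex of
      \<open>Q\<close> with four neighbours in \<open>Q\<close> and two in \<open>P\<close>, so they
      are equal.\<close>
    have "cut A B + d P s = cut Q P + d A s"
      using B sA fin
      by (simp add: Q_def cut_insert_left cut_insert_right)
    moreover have "cut A' B' + d P x = cut Q P + d A' x"
      using Q(2,3) B xP unfolding Q(1)
      by (simp add: B'_def cut_insert_left cut_insert_right)
    moreover have "d A s = 4"
      using dQ[of s] sA fin by (simp add: Q_def)
    moreover have "d A' x = 4"
      using dQ[OF x(1)] Q(2,3) unfolding Q(1) by simp
    ultimately have "cut A' B' = cut A B"
      using dP[of s] dP[of x] x by (simp add: Q_def)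
    then have min': "min_bipartition A' B'"
      using min bip' cards by (simp add: min_bipartition_def)
    have p': "p \<in> B'" "d B' p \<le> 2"
      using p x xP B by (simp_all add: B'_def adj_commute[of p x])
    have "d B' p = 2" "\<And>y. y \<in> Q - {x} \<Longrightarrow> d B' y = 2 + adj y p"
      using min_bipartition_violation(3)[OF min' p'] cards card by (auto simp: A'_def)
    \<comment> \<open>For \<open>y\<close> in \<open>Q - {x}\<close>, both 2 +
      \<open>adj y x\<close> and 2 + \<open>adj y p\<close> equal \<open>d B' y\<close>.\<close>
    then show ?thesis
      using dP x xP B by (simp add: B'_def adj_commute[of p x])
  qed
  have dpQ: "d Q p + d P p = 6"
    using d_bipartition[OF bipQ, of p] p QV by auto
  define X where "X = {x \<in> Q. adj x p = 0}"
  have X: "X \<subseteq> Q" "finite X"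
    using finQ by (auto simp: X_def)
  have dQp: "d Q p = card (Q - X)"
  proof -
    have "d Q p = (\<Sum>x\<in>Q. if x \<in> X then 0 else 1)"
      unfolding sum_adj_left[symmetric] by (intro sum.cong) (auto simp: X_def adj_def)
    then show ?thesis
      using finQ by (simp add: sum.If_cases Diff_eq Compl_eq)
  qed
  have cardX: "card X + d Q p = card Q"
    using X finQ card_mono[OF finQ X(1)] by (simp add: dQp card_Diff_subset)
  \<comment> \<open>At most six of the nine or more vertices of \<open>Q\<close> are adjacent to
    \<open>p\<close>. A single non-neighbour suffices to sharpen \<open>d P p \<le> 2\<close> to
    equality.\<close>
  then have "X \<noteq> {}"
    using dpQ cardQ by auto
  then have "d P p = 2"
    using twin by (auto simp: X_def)
  then have "d Q p = 4"
    using dpQ by simp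
  then have "Q - X \<noteq> {}"
    using dQp by (metis card.empty zero_neq_numeral)
  then obtain y where y: "y \<in> Q" "adj y p \<noteq> 0"
    by (auto simp: X_def)
  then have yp: "adj y p = 1"
    using adj_le_1[of y p] by simp
  have "adj y x = 1" if "x \<in> X" for x
    using twin[of x] y yp that by (cases "y = x") (auto simp: X_def)
  then have "card X = d X y"
    by (simp add: d_def)
  also have "\<dots> \<le> d Q y"
    using X finQ by (intro d_mono)
  finally have "card X \<le> 4"
    using dQ y by simp
  with cardX \<open>d Q p = 4\<close> cardQ show False
    by simp
qed

end

theorem theorem1:
  fixes G :: "'a pair_pre_digraph"
  assumes "pair_graph G"
    and "regular G 6"
    and "card (pverts G) \<ge> 14"
  shows "\<exists>A B. internal_partition G A B"
proof (rule ccontr)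
  assume "\<nexists>A B. internal_partition G A B"
  then interpret six_regular_no_internal G
    using assms unfolding six_regular_no_internal_def six_regular_no_internal_axioms_def
      six_regular_def regular_pair_graph_def regular_pair_graph_axioms_def by blast
  define n where "n = card (pverts G)"
  have "n - n div 2 \<le> card (pverts G)"
    by (simp add: n_def)
  then obtain A B where AB: "min_bipartition A B" and A: "card A = n - n div 2"
    using ex_min_bipartition by blast
  have "card A + card B = n"
    using AB card_bipartition by (simp add: min_bipartition_def n_def)
  with A have "card B = n div 2"
    by simp
  \<comment> \<open>The hypothesis of 14 vertices enters as a smaller side of at least 7.\<close>
  with A assms(3) have card: "card B \<le> card A" "card A \<le> Suc (card B)" "7 \<le> card B"
    unfolding n_def[symmetric] by linarith+
  then have "card B < card A"
    using min_bipartition_larger(2)[OF AB] by simp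
  then show False
    using min_bipartition_tight[OF AB] card by simp
qed

end
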